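(* Let $G$ be a twin-free graph on $n$ vertices. Then $LD(G) \leq \lceil \frac{5n}{8} \rceil$.
   Context: All graphs are finite and simple. Two distinct vertices $v,v'$ of a graph $G$ are twins if $N_G(v)\setminus\{v'\}=N_G(v')\setminus\{v\}$ (i.e. their open or closed neighbourhoods coincide); $G$ is twin-free if it has no pair of twins. For $X\subseteq V(G)$, $X$ distinguishes two vertices $v,v'\notin X$ if $N_G(v)\cap X\neq N_G(v')\cap X$. A set $X\subseteq V(G)$ is a locating set if every pair of distinct vertices of $V(G)\setminus X$ is distinguished by $X$. A set $X$ is dominating if every vertex of $V(G)\setminus X$ has a neighbour in $X$. A locating-dominating set is a set that is both locating and dominating, and $LD(G)$ denotes the minimum size of a locating-dominating set of $G$. *)

theory Defs
  imports Complex_Main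
begin

definition simple_graph :: "'a set \<Rightarrow> 'a set set \<Rightarrow> bool" where
  "simple_graph V E \<longleftrightarrow> finite V \<and> (\<forall>e\<in>E. e \<subseteq> V \<and> card e = 2)"

definition nbhd :: "'a set \<Rightarrow> 'a set set \<Rightarrow> 'a \<Rightarrow> 'a set" where
  "nbhd V E v = {u \<in> V. {u, v} \<in> E}"

definition twins :: "'a set \<Rightarrow> 'a set set \<Rightarrow> 'a \<Rightarrow> 'a \<Rightarrow> bool" where
  "twins V E v v' \<longleftrightarrow> v \<in> V \<and> v' \<in> V \<and> v \<noteq> v' \<and>
     nbhd V E v - {v'} = nbhd V E v' - {v}"

definition twin_free :: "'a set \<Rightarrow> 'a set set \<Rightarrow> bool" where
  "twin_free V E \<longleftrightarrow> (\<forall>v v'. \<not> twins V E v v')"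

definition distinguishes :: "'a set \<Rightarrow> 'a set set \<Rightarrow> 'a set \<Rightarrow> 'a \<Rightarrow> 'a \<Rightarrow> bool" where
  "distinguishes V E X v v' \<longleftrightarrow> nbhd V E v \<inter> X \<noteq> nbhd V E v' \<inter> X"

definition locating :: "'a set \<Rightarrow> 'a set set \<Rightarrow> 'a set \<Rightarrow> bool" where
  "locating V E X \<longleftrightarrow> X \<subseteq> V \<and>
     (\<forall>v\<in>V - X. \<forall>v'\<in>V - X. v \<noteq> v' \<longrightarrow> distinguishes V E X v v')"

definition dominating :: "'a set \<Rightarrow> 'a set set \<Rightarrow> 'a set \<Rightarrow> bool" where
  "dominating V E X \<longleftrightarrow> X \<subseteq> V \<and> (\<forall>v\<in>V - X. nbhd V E v \<inter> X \<noteq> {})"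

definition locating_dominating :: "'a set \<Rightarrow> 'a set set \<Rightarrow> 'a set \<Rightarrow> bool" where
  "locating_dominating V E X \<longleftrightarrow> locating V E X \<and> dominating V E X"

definition LD :: "'a set \<Rightarrow> 'a set set \<Rightarrow> nat" where
  "LD V E = Min (card ` {X. locating_dominating V E X})"

end

theory Submission
  imports Defs
begin

text \<open>
  For \<open>Y \<subseteq> V\<close> let \<open>f Y\<close> be the number of traces \<open>N(v) \<inter> Y\<close> of vertices \<open>v \<notin> Y\<close>. Take \<open>X\<close>
  maximising \<open>f\<close> and, among those, of least size. Let \<open>S\<close> be the vertices outside \<open>X\<close> whose trace
  on \<open>X\<close> is unique, \<open>C\<close> the other vertices outside \<open>X\<close>, and \<open>R\<close> a transversal of the trace classes
  in \<open>C\<close>. Maximality of \<open>f X\<close> says that no vertex of \<open>C\<close> tells apart two other vertices of the same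
  class, so \<open>V - C\<close> is locating; minimality of \<open>X\<close> makes \<open>V - X\<close> locating; and \<open>V - (S \<union> R)\<close> is
  locating for trivial reasons. Fewer than \<open>|R|\<close> vertices of \<open>X\<close> suffice to tell the elements of
  \<open>R\<close> apart; let \<open>X'\<close> consist of them and put \<open>Z = X - X'\<close>. The only pairs that \<open>S \<union> R \<union> X'\<close> fails
  to distinguish are pairs \<open>x \<in> Z\<close>, \<open>c \<in> C - R\<close> forming a partial matching, and they are
  distinguished by vertices of \<open>Z\<close>, through a relation that is symmetric on the matched vertices. As
  in Ore's theorem on dominating sets, \<open>Z\<close> then splits into two parts each of which resolves all
  these pairs, which gives two more locating sets. Weighting the five sizes by \<open>2, 3, 1, 1, 1\<close>
  (for \<open>V - X\<close>, \<open>V - (S \<union> R)\<close>, \<open>V - C\<close> and the last two) gives total at most \<open>5n - 1\<close>, so some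
  locating set has fewer than \<open>5n/8\<close> elements; at most one vertex is left undominated by it.
\<close>

section \<open>Separating subsets and Ore-type complementary domination\<close>

lemma separating_subset:
  assumes "finite R" "R \<noteq> {}"
    and "\<And>u v. u \<in> R \<Longrightarrow> v \<in> R \<Longrightarrow> u \<noteq> v \<Longrightarrow> \<exists>w\<in>X. Q w u \<noteq> Q w v"
  shows "\<exists>X'\<subseteq>X. finite X' \<and> card X' < card R \<and>
    (\<forall>u\<in>R. \<forall>v\<in>R. u \<noteq> v \<longrightarrow> (\<exists>w\<in>X'. Q w u \<noteq> Q w v))"
  using assms
proof (induction R rule: finite_ne_induct)
  case (singleton x)
  then show ?case by (intro exI[of _ "{}"]) auto
next
  case (insert r R)
  then obtain Y where Y: "Y \<subseteq> X" "finite Y" "card Y < card R"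
    and sep: "\<forall>u\<in>R. \<forall>v\<in>R. u \<noteq> v \<longrightarrow> (\<exists>w\<in>Y. Q w u \<noteq> Q w v)"
    by (metis insertI2)
  show ?case
  proof (cases "\<exists>u\<in>R. \<forall>w\<in>Y. Q w u = Q w r")
    case True
    then obtain u where u: "u \<in> R" "\<forall>w\<in>Y. Q w u = Q w r" by blast
    \<comment> \<open>Since \<open>Y\<close> separates \<open>R\<close>, only \<open>u\<close>
      agrees with \<open>r\<close> on \<open>Y\<close>. One further element \<open>w\<close>,
      telling \<open>u\<close> from \<open>r\<close>, therefore suffices.\<close>
    with insert.hyps insert.prems[of u r] obtain w where w: "w \<in> X" "Q w u \<noteq> Q w r" by auto
    have new: "\<exists>y\<in>insert w Y. Q y v \<noteq> Q y r" if v: "v \<in> R" for v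
    proof (cases "v = u")
      case True then show ?thesis using w by auto
    next
      case False
      then obtain y where "y \<in> Y" "Q y v \<noteq> Q y u" using sep u v by blast
      then show ?thesis using u by auto
    qed
    have "card (insert w Y) < card (insert r R)"
      using Y insert.hyps by (simp add: card_insert_if)
    moreover have "\<forall>u\<in>insert r R. \<forall>v\<in>insert r R. u \<noteq> v \<longrightarrow> (\<exists>y\<in>insert w Y. Q y u \<noteq> Q y v)"
      using new sep by (metis insert_iff)
    ultimately show ?thesis using Y w by (intro exI[of _ "insert w Y"]) auto
  next
    case False
    have "card Y < card (insert r R)" using Y insert.hyps by simp
    moreover have "\<forall>u\<in>insert r R. \<forall>v\<in>insert r R. u \<noteq> v \<longrightarrow> (\<exists>y\<in>Y. Q y u \<noteq> Q y v)"
      using False sep by (metis insert_iff)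
    ultimately show ?thesis using Y by (intro exI[of _ Y]) auto
  qed
qed

text \<open>Ore's argument with a minimum dominating \<open>D\<close>: if some \<open>x\<close> in
  \<open>P\<close> and \<open>D\<close> had no neighbour outside \<open>D\<close>, it would have one
  inside. Deleting \<open>x\<close> could then only leave undominated some \<open>p\<close> outside
  \<open>D\<close> with \<open>N p x\<close>, and symmetry makes this \<open>p\<close> a neighbour
  of \<open>x\<close> outside \<open>D\<close>.\<close>

lemma complementary_dominating_sets:
  fixes N :: "'a \<Rightarrow> 'a \<Rightarrow> bool"
  assumes "finite Z" "P \<subseteq> Z"
    and nb: "\<And>x. x \<in> P \<Longrightarrow> \<exists>z\<in>Z. z \<noteq> x \<and> N x z"
    and sym: "\<And>x z. x \<in> P \<Longrightarrow> z \<in> P \<Longrightarrow> x \<noteq> z \<Longrightarrow> N x z \<Longrightarrow> N z x"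
  shows "\<exists>D\<subseteq>Z. (\<forall>x\<in>P. x \<in> D \<or> (\<exists>z\<in>D. N x z)) \<and> (\<forall>x\<in>P. x \<in> Z - D \<or> (\<exists>z\<in>Z - D. N x z))"
proof -
  define dom where "dom D \<longleftrightarrow> (\<forall>x\<in>P. x \<in> D \<or> (\<exists>z\<in>D. z \<noteq> x \<and> N x z))" for D
  have "dom Z" using \<open>P \<subseteq> Z\<close> by (auto simp: dom_def)
  then obtain D where D: "D \<subseteq> Z" "dom D"
    and min: "\<And>D'. D' \<subseteq> Z \<Longrightarrow> dom D' \<Longrightarrow> card D \<le> card D'"
    using ex_has_least_nat[of "\<lambda>D. D \<subseteq> Z \<and> dom D" Z card] by auto
  have "\<exists>z\<in>Z - D. N x z" if x: "x \<in> P" "x \<in> D" for x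
  proof (rule ccontr)
    assume none: "\<not> (\<exists>z\<in>Z - D. N x z)"
    have "card (D - {x}) < card D"
      using x D \<open>finite Z\<close> by (meson card_Diff1_less finite_subset)
    then have "\<not> dom (D - {x})" using min[of "D - {x}"] D by auto
    then obtain p where p: "p \<in> P" "p \<notin> D - {x}" "\<forall>z\<in>D - {x}. z = p \<or> \<not> N p z"
      by (auto simp: dom_def)
    have "p \<noteq> x" using nb[OF x(1)] none p by auto
    then have "p \<notin> D" "N p x" using p D(2) by (auto simp: dom_def)
    then show False using sym[OF p(1) x(1)] \<open>p \<noteq> x\<close> none p(1) \<open>P \<subseteq> Z\<close> by auto
  qed
  then show ?thesis using D \<open>P \<subseteq> Z\<close> by (intro exI[of _ D]) (auto simp: dom_def)
qed

section \<open>Traces in twin-free graphs\<close>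

locale twin_free_graph =
  fixes V :: "'a set" and E :: "'a set set"
  assumes graph: "simple_graph V E" and no_twins: "twin_free V E"
begin

abbreviation adj :: "'a \<Rightarrow> 'a \<Rightarrow> bool" where
  "adj u v \<equiv> {u, v} \<in> E"

definition tr :: "'a set \<Rightarrow> 'a \<Rightarrow> 'a set" where
  "tr Y v = {w \<in> Y. adj w v}"

definition num_tr :: "'a set \<Rightarrow> nat" where
  "num_tr Y = card (tr Y ` (V - Y))"

lemma finite_V: "finite V"
  using graph by (simp add: simple_graph_def)

lemma adj_sym: "adj u v \<longleftrightarrow> adj v u"
  by (simp add: insert_commute)

lemma adj_irrefl: "\<not> adj v v"
  using graph by (force simp: simple_graph_def)

lemma distinguishing_vertex:
  assumes "u \<in> V" "v \<in> V" "u \<noteq> v"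
  shows "\<exists>w\<in>V. w \<noteq> u \<and> w \<noteq> v \<and> adj w u \<noteq> adj w v"
proof -
  have "nbhd V E u - {v} \<noteq> nbhd V E v - {u}"
    using no_twins assms by (auto simp: twin_free_def twins_def)
  then obtain w where "w \<in> V" "(adj w u \<and> w \<noteq> v) \<noteq> (adj w v \<and> w \<noteq> u)"
    by (auto simp: nbhd_def)
  then show ?thesis using adj_irrefl[of u] adj_irrefl[of v] by metis
qed

lemma tr_eq_iff: "tr Y u = tr Y v \<longleftrightarrow> (\<forall>w\<in>Y. adj w u = adj w v)"
  by (auto simp: tr_def)

lemma locatingI:
  assumes "Y \<subseteq> V"
    and "\<And>u v. u \<in> V - Y \<Longrightarrow> v \<in> V - Y \<Longrightarrow> u \<noteq> v \<Longrightarrow> \<exists>w\<in>Y. adj w u \<noteq> adj w v"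
  shows "locating V E Y"
proof -
  have "nbhd V E v \<inter> Y = tr Y v" for v using assms(1) by (auto simp: nbhd_def tr_def)
  then show ?thesis using assms by (simp add: locating_def distinguishes_def tr_eq_iff)
qed

text \<open>Among the maximisers of \<open>num_tr\<close>, one of least cardinality works: deleting
  a vertex leaves a smaller set, which cannot be a maximiser.\<close>

lemma exists_extremal:
  "\<exists>X\<subseteq>V. (\<forall>w\<in>V - X. num_tr (insert w X) \<le> num_tr X) \<and> (\<forall>x\<in>X. num_tr (X - {x}) < num_tr X)"
proof -
  have fin: "finite (num_tr ` Pow V)" using finite_V by simp
  then have "Max (num_tr ` Pow V) \<in> num_tr ` Pow V" by (intro Max_in) auto
  then obtain X0 where "X0 \<subseteq> V" "num_tr X0 = Max (num_tr ` Pow V)" by auto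
  then have X0: "X0 \<subseteq> V" "\<And>Y. Y \<subseteq> V \<Longrightarrow> num_tr Y \<le> num_tr X0"
    using fin by auto
  obtain X where X: "X \<subseteq> V" "num_tr X = num_tr X0"
    and min: "\<And>Y. Y \<subseteq> V \<Longrightarrow> num_tr Y = num_tr X0 \<Longrightarrow> card X \<le> card Y"
    using ex_has_least_nat[of "\<lambda>Y. Y \<subseteq> V \<and> num_tr Y = num_tr X0" X0 card] X0(1) by auto
  have "num_tr (X - {x}) < num_tr X" if "x \<in> X" for x
  proof -
    have "card (X - {x}) < card X"
      using that X finite_V by (meson card_Diff1_less finite_subset)
    then have "num_tr (X - {x}) \<noteq> num_tr X" using min[of "X - {x}"] X by auto
    moreover have "num_tr (X - {x}) \<le> num_tr X0" using X0(2) X(1) by blast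
    ultimately show ?thesis using X(2) by simp
  qed
  moreover have "num_tr (insert w X) \<le> num_tr X" if "w \<in> V - X" for w
  proof -
    have "insert w X \<subseteq> V" using that X(1) by blast
    then show ?thesis using X0(2) X(2) by simp
  qed
  ultimately show ?thesis using X(1) by (intro exI[of _ X]) simp
qed

text \<open>Distinct vertices outside \<open>Y\<close> have distinct traces, so at most one trace is
  empty; adding its vertex suffices.\<close>

lemma locating_imp_locating_dominating:
  assumes "locating V E Y"
  shows "\<exists>Y'. locating_dominating V E Y' \<and> card Y' \<le> card Y + 1"
proof (cases "dominating V E Y")
  case True
  then show ?thesis using assms by (auto simp: locating_dominating_def)
next
  case False
  have Y: "Y \<subseteq> V" using assms by (simp add: locating_def)
  with False obtain v where v: "v \<in> V - Y" "nbhd V E v \<inter> Y = {}" by (auto simp: dominating_def)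
  have "locating V E (insert v Y)"
    using assms v(1) by (auto simp: locating_def distinguishes_def)
  moreover have "dominating V E (insert v Y)"
    unfolding dominating_def
  proof (intro conjI ballI)
    fix u assume u: "u \<in> V - insert v Y"
    then have "nbhd V E u \<inter> Y \<noteq> nbhd V E v \<inter> Y"
      using assms v(1) by (auto simp: locating_def distinguishes_def)
    then show "nbhd V E u \<inter> insert v Y \<noteq> {}" using v(2) by auto
  qed (use Y v in auto)
  moreover have "card (insert v Y) \<le> card Y + 1"
    using finite_subset[OF Y finite_V] by (simp add: card_insert_if)
  ultimately show ?thesis by (auto simp: locating_dominating_def)
qed

end

section \<open>The partition given by an extremal set\<close>

locale extremal_trace_set = twin_free_graph +
  fixes X :: "'a set"
  assumes X_subset: "X \<subseteq> V"
    and insert_le: "w \<in> V - X \<Longrightarrow> num_tr (insert w X) \<le> num_tr X"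
    and remove_less: "x \<in> X \<Longrightarrow> num_tr (X - {x}) < num_tr X"
begin

definition S :: "'a set" where
  "S = {v \<in> V - X. \<forall>u\<in>V - X. tr X u = tr X v \<longrightarrow> u = v}"

definition C :: "'a set" where
  "C = V - X - S"

text \<open>The choice depends on \<open>tr X v\<close> alone, so \<open>rep\<close> is constant on
  trace classes and \<open>R\<close> meets each class inside \<open>C\<close> exactly once.\<close>

definition rep :: "'a \<Rightarrow> 'a" where
  "rep v = (SOME u. u \<in> V - X \<and> tr X u = tr X v)"

definition R :: "'a set" where
  "R = rep ` C"

lemma rep: "v \<in> V - X \<Longrightarrow> rep v \<in> V - X \<and> tr X (rep v) = tr X v"
  unfolding rep_def by (rule someI[of _ v]) auto

lemma rep_S: "v \<in> S \<Longrightarrow> rep v = v"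
  using rep[of v] by (auto simp: S_def)

lemma rep_C:
  assumes "c \<in> C" shows "rep c \<in> C"
proof -
  obtain u where "u \<in> V - X" "c \<in> V - X" "tr X u = tr X c" "u \<noteq> c"
    using assms by (auto simp: C_def S_def)
  then show ?thesis using rep[of c] by (cases "rep c = c") (auto simp: C_def S_def)
qed

lemma rep_eqI: "tr X u = tr X v \<Longrightarrow> rep u = rep v"
  by (simp add: rep_def)

lemma R_subset: "R \<subseteq> C"
  using rep_C by (auto simp: R_def)

lemma adj_rep: "x \<in> X \<Longrightarrow> c \<in> C \<Longrightarrow> adj x (rep c) = adj x c"
  using rep[of c] by (auto simp: C_def tr_eq_iff)

lemma R_separated:
  assumes "r \<in> R" "r' \<in> R" "r \<noteq> r'"
  shows "\<exists>w\<in>X. adj w r \<noteq> adj w r'"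
proof -
  obtain c c' where c: "c \<in> C" "c' \<in> C" "r = rep c" "r' = rep c'" using assms by (auto simp: R_def)
  then have "tr X r \<noteq> tr X r'" using assms(3) rep[of c] rep[of c'] rep_eqI[of c c']
    by (auto simp: C_def)
  then show ?thesis by (auto simp: tr_eq_iff)
qed

lemma finite_sets: "finite X" "finite S" "finite C" "finite R"
  using finite_V X_subset by (auto simp: C_def S_def R_def intro: finite_subset)

lemma card_V: "card V = card X + card S + card C"
proof -
  have "V = X \<union> (S \<union> C)" "X \<inter> (S \<union> C) = {}" "S \<inter> C = {}"
    using X_subset by (auto simp: C_def S_def)
  then show ?thesis using finite_sets card_Un_disjoint[of X "S \<union> C"] card_Un_disjoint[of S C]
    by (metis add.assoc finite_Un)
qed

text \<open>Otherwise moving \<open>w\<close> into \<open>X\<close> would raise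
  \<open>num_tr\<close>: another member of its class keeps the old trace of \<open>w\<close> alive,
  while the trace shared by \<open>u\<close> and \<open>v\<close> splits in two.\<close>

lemma no_split:
  assumes w: "w \<in> C" and uv: "u \<in> V - X" "v \<in> V - X" "u \<noteq> w" "v \<noteq> w" "tr X u = tr X v"
  shows "adj w u = adj w v"
proof (rule ccontr)
  assume ne: "adj w u \<noteq> adj w v"
  obtain w' where w': "w' \<in> V - X" "w' \<noteq> w" "tr X w' = tr X w"
    using w by (auto simp: C_def S_def)
  let ?T = "tr (insert w X) ` (V - insert w X)"
  have wX: "w \<in> V - X" using w by (auto simp: C_def)
  have restr: "tr (insert w X) y \<inter> X = tr X y" for y using wX by (auto simp: tr_def)
  have "(\<lambda>t. t \<inter> X) ` ?T = tr X ` (V - insert w X)"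
    by (simp add: image_image restr)
  also have "\<dots> = tr X ` (V - X)"
    using w' wX by auto
  finally have im: "(\<lambda>t. t \<inter> X) ` ?T = tr X ` (V - X)" .
  have fin: "finite ?T" using finite_V by simp
  have "\<not> inj_on (\<lambda>t. t \<inter> X) ?T"
  proof
    assume "inj_on (\<lambda>t. t \<inter> X) ?T"
    then have "tr (insert w X) u = tr (insert w X) v"
      using uv by (elim inj_onD) (auto simp: restr)
    then show False using ne by (simp add: tr_eq_iff)
  qed
  \<comment> \<open>Restriction to \<open>X\<close> maps the new traces onto the old ones, but not
    injectively.\<close>
  then have "num_tr X < num_tr (insert w X)"
    using card_image_le[OF fin, of "\<lambda>t. t \<inter> X"] eq_card_imp_inj_on[OF fin, of "\<lambda>t. t \<inter> X"]
    unfolding num_tr_def im by linarith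
  then show False using insert_le[OF wX] by simp
qed

text \<open>Vertices of \<open>C\<close> see \<open>X\<close> as their representatives do, so
  otherwise no vertex outside \<open>X\<close> would separate \<open>x\<close> from
  \<open>x'\<close>. Deleting \<open>x\<close> would then merge no traces, contrary to
  \<open>remove_less\<close>.\<close>

lemma X_separated:
  assumes x: "x \<in> X" "x' \<in> X" "x \<noteq> x'"
  shows "\<exists>w\<in>S \<union> R. adj w x \<noteq> adj w x'"
proof (rule ccontr)
  assume none: "\<not> (\<exists>w\<in>S \<union> R. adj w x \<noteq> adj w x')"
  have eq: "adj w x = adj w x'" if w: "w \<in> V - X" for w
  proof (cases "w \<in> S")
    case False
    then have c: "w \<in> C" using w by (simp add: C_def)
    then have "rep w \<in> R" by (simp add: R_def)
    then have "adj (rep w) x = adj (rep w) x'" using none by auto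
    then show ?thesis using adj_rep[OF x(1) c] adj_rep[OF x(2) c] by (simp add: adj_sym)
  qed (use none in auto)
  have "inj_on (\<lambda>t. t - {x}) (tr X ` (V - X))"
  proof (rule inj_onI)
    fix s t assume s: "s \<in> tr X ` (V - X)" and t: "t \<in> tr X ` (V - X)" and st: "s - {x} = t - {x}"
    have "x \<in> q \<longleftrightarrow> x' \<in> q" if q: "q \<in> tr X ` (V - X)" for q
    proof -
      obtain w where "w \<in> V - X" "q = tr X w" using q by blast
      then show ?thesis using x(1,2) eq[of w] adj_sym[of x w] adj_sym[of x' w] by (simp add: tr_def)
    qed
    then have "x \<in> s \<longleftrightarrow> x' \<in> s" "x \<in> t \<longleftrightarrow> x' \<in> t" using s t by blast+
    then show "s = t" using st x(3) by blast
  qed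
  then have "num_tr X = card ((\<lambda>t. t - {x}) ` tr X ` (V - X))"
    by (simp add: num_tr_def card_image)
  also have "(\<lambda>t. t - {x}) ` tr X ` (V - X) = tr (X - {x}) ` (V - X)"
    unfolding image_image by (rule image_cong) (auto simp: tr_def)
  \<comment> \<open>Only an inequality: \<open>x\<close> itself now lies outside and may add a
    trace.\<close>
  also have "card \<dots> \<le> num_tr (X - {x})"
    unfolding num_tr_def using finite_V by (intro card_mono) auto
  finally show False using remove_less[OF x(1)] by simp
qed

text \<open>Twin-freeness supplies a distinguishing vertex; equal traces keep it out of
  \<open>X\<close>, and \<open>no_split\<close> keeps it out of \<open>C\<close>.\<close>

lemma class_separated_by_S:
  assumes "c \<in> C" "c' \<in> C" "c \<noteq> c'" "tr X c = tr X c'"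
  shows "\<exists>w\<in>S. adj w c \<noteq> adj w c'"
proof -
  have V: "c \<in> V - X" "c' \<in> V - X" using assms by (auto simp: C_def)
  then obtain w where w: "w \<in> V" "w \<noteq> c" "w \<noteq> c'" "adj w c \<noteq> adj w c'"
    using distinguishing_vertex[of c c'] assms by auto
  have "w \<notin> X" using w assms(4) by (auto simp: tr_eq_iff)
  moreover have "w \<notin> C" using no_split[OF _ V] w assms(4) by auto
  ultimately show ?thesis using w by (auto simp: C_def)
qed

lemma locating_compl_X: "locating V E (V - X)"
proof (rule locatingI)
  fix u v assume "u \<in> V - (V - X)" "v \<in> V - (V - X)" "u \<noteq> v"
  then show "\<exists>w\<in>V - X. adj w u \<noteq> adj w v"
    using X_separated[of u v] R_subset by (auto simp: S_def C_def)
qed auto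

lemma locating_compl_C: "locating V E (V - C)"
proof (rule locatingI)
  fix u v assume "u \<in> V - (V - C)" "v \<in> V - (V - C)" "u \<noteq> v"
  then show "\<exists>w\<in>V - C. adj w u \<noteq> adj w v"
    using class_separated_by_S[of u v] X_subset
    by (cases "tr X u = tr X v") (auto simp: tr_eq_iff C_def S_def)
qed auto

lemma locating_compl_S_R: "locating V E (V - (S \<union> R))"
proof (rule locatingI)
  fix u v assume "u \<in> V - (V - (S \<union> R))" "v \<in> V - (V - (S \<union> R))" and ne: "u \<noteq> v"
  then have uv: "u \<in> S \<union> R" "v \<in> S \<union> R" "u \<in> V - X" "v \<in> V - X"
    using R_subset by (auto simp: S_def C_def)
  then have "tr X u \<noteq> tr X v"
    using ne R_separated[of u v] by (auto simp: S_def tr_eq_iff)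
  then obtain w where "w \<in> X" "adj w u \<noteq> adj w v" by (auto simp: tr_eq_iff)
  moreover have "X \<subseteq> V - (S \<union> R)" using X_subset R_subset by (auto simp: S_def C_def)
  ultimately show "\<exists>w\<in>V - (S \<union> R). adj w u \<noteq> adj w v" by blast
qed auto

section \<open>Two complementary locating sets\<close>

lemma complementary_extensions:
  assumes X': "X' \<subseteq> X" and sepR: "\<And>u v. u \<in> R \<Longrightarrow> v \<in> R \<Longrightarrow> u \<noteq> v \<Longrightarrow> \<exists>w\<in>X'. adj w u \<noteq> adj w v"
  shows "\<exists>D\<subseteq>X - X'. locating V E (S \<union> R \<union> X' \<union> D) \<and> locating V E (S \<union> R \<union> X' \<union> (X - X' - D))"
proof -
  define Z where "Z = X - X'"
  define Y where "Y = S \<union> R \<union> X'"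
  \<comment> \<open>Bad pairs are those that \<open>Y\<close> leaves unresolved, and
    \<open>N x z\<close> says that \<open>z\<close> resolves the pair at \<open>x\<close>.
    Dominating \<open>P\<close> under \<open>N\<close> thus amounts to handling every bad
    pair.\<close>
  define bad where "bad x c \<longleftrightarrow> x \<in> Z \<and> c \<in> C - R \<and> tr Y x = tr Y c" for x c
  define N where "N x z \<longleftrightarrow> (\<exists>c. bad x c \<and> adj z x \<noteq> adj z c)" for x z
  define P where "P = {x \<in> Z. \<exists>c. bad x c}"
  have YV: "Y \<subseteq> V" using X' X_subset R_subset by (auto simp: Y_def S_def C_def)
  have Z: "Z \<subseteq> X" by (auto simp: Z_def)
  \<comment> \<open>Within a class \<open>S\<close> separates; across classes \<open>X'\<close>
    separates the representatives, hence also \<open>u\<close> and \<open>v\<close>.\<close>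
  have sepC: "\<exists>w\<in>Y. adj w u \<noteq> adj w v" if uv: "u \<in> C" "v \<in> C" "u \<noteq> v" for u v
  proof (cases "tr X u = tr X v")
    case True
    then show ?thesis using class_separated_by_S[of u v] uv by (auto simp: Y_def)
  next
    case False
    have "rep u \<in> R" "rep v \<in> R" using uv by (auto simp: R_def)
    moreover have "rep u \<noteq> rep v"
      using False uv rep[of u] rep[of v] by (auto simp: C_def)
    ultimately obtain w where "w \<in> X'" "adj w (rep u) \<noteq> adj w (rep v)" using sepR by blast
    then show ?thesis using X' uv adj_rep[of w u] adj_rep[of w v] by (auto simp: Y_def)
  qed
  have bad_unique: "c = d" if "bad x c" "bad x d" for x c d
    using that sepC[of c d] by (auto simp: bad_def tr_eq_iff)
  have C_adj_rep: "adj c (rep d) = adj c d" if "c \<in> C" "c \<notin> R" "d \<in> C" "c \<noteq> d" for c d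
  proof -
    have "rep d \<noteq> c" using that by (auto simp: R_def)
    then show ?thesis using no_split[of c "rep d" d] rep[of d] that by (auto simp: C_def)
  qed
  \<comment> \<open>The link is \<open>rep d\<close>, which lies in \<open>Y\<close>: it does not
    tell \<open>x\<close> from \<open>c\<close>, and \<open>x\<close> does not tell it from
    \<open>d\<close>.\<close>
  have bad_adj_rep: "adj x d = adj c (rep d)" if "bad x c" "d \<in> C" for x c d
  proof -
    have "rep d \<in> Y" using that by (auto simp: R_def Y_def)
    then have "adj (rep d) x = adj (rep d) c" using that by (auto simp: bad_def tr_eq_iff)
    moreover have "adj x (rep d) = adj x d" using that Z by (intro adj_rep) (auto simp: bad_def)
    ultimately show ?thesis by (simp add: adj_sym)
  qed
  have nb: "\<exists>z\<in>Z. z \<noteq> x \<and> N x z" if x: "x \<in> P" for x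
  proof -
    obtain c where c: "bad x c" using x by (auto simp: P_def)
    then have x: "x \<in> X" and cC: "c \<in> C" "c \<notin> R" using Z by (auto simp: bad_def)
    then have "x \<in> V" "c \<in> V" "x \<noteq> c" using X_subset by (auto simp: C_def)
    then obtain w where w: "w \<in> V" "w \<noteq> x" "w \<noteq> c" "adj w x \<noteq> adj w c"
      using distinguishing_vertex by blast
    have "w \<notin> Y" using c w by (auto simp: bad_def tr_eq_iff)
    \<comment> \<open>For \<open>w\<close> in \<open>C\<close>,
      \<open>adj x w = adj c (rep w) = adj c w\<close>, against the choice of
      \<open>w\<close>.\<close>
    moreover have "w \<notin> C"
      using bad_adj_rep[OF c, of w] C_adj_rep[OF cC, of w] w
      by (auto simp: adj_sym[of w])
    ultimately have "w \<in> Z" using w(1) by (auto simp: Y_def Z_def C_def)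
    then show ?thesis using w c by (auto simp: N_def)
  qed
  have sym: "N z x" if xz: "x \<in> P" "z \<in> P" "x \<noteq> z" "N x z" for x z
  proof -
    obtain c where c: "bad x c" "adj z x \<noteq> adj z c" using xz(4) by (auto simp: N_def)
    obtain d where d: "bad z d" using xz(2) by (auto simp: P_def)
    have C: "c \<in> C" "c \<notin> R" "d \<in> C" "d \<notin> R" using c d by (auto simp: bad_def)
    \<comment> \<open>Both sides equal \<open>adj c d\<close> if \<open>c\<close> and
      \<open>d\<close> differ, and \<open>adj c (rep c)\<close> if they coincide.\<close>
    have "adj z c = adj x d"
    proof (cases "c = d")
      case True
      then show ?thesis using bad_adj_rep[OF c(1)] bad_adj_rep[OF d] C by metis
    next
      case False
      then have "adj z c = adj d c" "adj x d = adj c d"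
        using bad_adj_rep[OF c(1), of d] bad_adj_rep[OF d, of c] C_adj_rep[of c d] C_adj_rep[of d c] C
        by auto
      then show ?thesis by (simp add: adj_sym)
    qed
    then have "adj x z \<noteq> adj x d" using c(2) by (simp add: adj_sym)
    then show ?thesis using d by (auto simp: N_def)
  qed
  have loc: "locating V E (Y \<union> D)"
    if D: "D \<subseteq> Z" and dom: "\<forall>x\<in>P. x \<in> D \<or> (\<exists>z\<in>D. N x z)" for D
  proof (rule locatingI)
    show "Y \<union> D \<subseteq> V" using YV D Z X_subset by auto
    have mixed: "\<exists>w\<in>Y \<union> D. adj w x \<noteq> adj w c" if xc: "x \<in> Z - D" "c \<in> C - R" for x c
    proof (cases "bad x c")
      case True
      \<comment> \<open>The partner hidden in \<open>N x z\<close> is \<open>c\<close> itself, by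
        \<open>bad_unique\<close>.\<close>
      then obtain z where "z \<in> D" "N x z" using xc dom by (auto simp: P_def)
      then show ?thesis using True bad_unique by (auto simp: N_def)
    next
      case False
      then show ?thesis using xc by (auto simp: bad_def tr_eq_iff)
    qed
    fix u v assume uv: "u \<in> V - (Y \<union> D)" "v \<in> V - (Y \<union> D)" "u \<noteq> v"
    then have "u \<in> Z - D \<or> u \<in> C - R" "v \<in> Z - D \<or> v \<in> C - R"
      by (auto simp: Y_def Z_def C_def)
    then consider "u \<in> X" "v \<in> X" | "u \<in> C" "v \<in> C"
      | "u \<in> Z - D" "v \<in> C - R" | "u \<in> C - R" "v \<in> Z - D" using Z by blast
    then show "\<exists>w\<in>Y \<union> D. adj w u \<noteq> adj w v"
    proof cases
      case 1 then show ?thesis using X_separated[of u v] uv by (auto simp: Y_def)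
    next
      case 2 then show ?thesis using sepC[of u v] uv by auto
    next
      case 3 then show ?thesis using mixed by blast
    next
      case 4 then show ?thesis using mixed[of v u] by metis
    qed
  qed
  have "finite Z" "P \<subseteq> Z" using Z finite_sets by (auto simp: P_def intro: finite_subset)
  then obtain D where "D \<subseteq> Z" "\<forall>x\<in>P. x \<in> D \<or> (\<exists>z\<in>D. N x z)"
    "\<forall>x\<in>P. x \<in> Z - D \<or> (\<exists>z\<in>Z - D. N x z)"
    using complementary_dominating_sets[of Z P N, OF _ _ nb sym] by blast
  then show ?thesis using loc[of D] loc[of "Z - D"] by (auto simp: Y_def Z_def)
qed

section \<open>Weighted counting\<close>

lemma exists_small_locating:
  assumes "V \<noteq> {}"
  shows "\<exists>Y. locating V E Y \<and> 8 * card Y < 5 * card V"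
proof (rule ccontr)
  assume "\<not> ?thesis"
  then have large: "5 * card V \<le> 8 * card Y" if "locating V E Y" for Y
    using that by (auto simp: not_less)
  have V: "0 < card V" using assms finite_V by (simp add: card_gt_0_iff)
  have sub: "S \<subseteq> V" "C \<subseteq> V" "R \<subseteq> C" "S \<inter> C = {}" "X \<inter> (S \<union> C) = {}"
    using R_subset by (auto simp: S_def C_def)
  have SR: "card (S \<union> R) = card S + card R"
    using sub finite_sets by (intro card_Un_disjoint) auto
  have RC: "card R \<le> card C" using sub finite_sets by (intro card_mono) auto
  have b1: "5 * card V \<le> 8 * (card S + card C)"
    using large[OF locating_compl_X] X_subset finite_sets card_V by (simp add: card_Diff_subset)
  have b2: "5 * card V \<le> 8 * (card X + card S)"
    using large[OF locating_compl_C] sub finite_sets card_V by (simp add: card_Diff_subset)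
  have "card (V - (S \<union> R)) = card V - card (S \<union> R)"
    using sub finite_sets by (intro card_Diff_subset) auto
  then have b3: "5 * card V + 8 * card R \<le> 8 * (card X + card C)"
    using large[OF locating_compl_S_R] SR card_V RC by simp
  show False
  proof (cases "R = {}")
    \<comment> \<open>No \<open>X'\<close> with fewer than \<open>card R\<close> elements exists
      here. But \<open>V\<close> is just \<open>X\<close> and \<open>S\<close>, and both would have
      at least 5/8 of its vertices.\<close>
    case True
    then have "C = {}" by (simp add: R_def)
    then show False using b1 b3 card_V V by auto
  next
    case False
    have "\<exists>X'\<subseteq>X. finite X' \<and> card X' < card R \<and>
        (\<forall>u\<in>R. \<forall>v\<in>R. u \<noteq> v \<longrightarrow> (\<exists>w\<in>X'. adj w u \<noteq> adj w v))"
      by (rule separating_subset[OF finite_sets(4) False]) (rule R_separated)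
    then obtain X' where X': "X' \<subseteq> X" "card X' < card R"
      and sep: "\<forall>u\<in>R. \<forall>v\<in>R. u \<noteq> v \<longrightarrow> (\<exists>w\<in>X'. adj w u \<noteq> adj w v)"
      by blast
    then obtain D where D: "D \<subseteq> X - X'" "locating V E (S \<union> R \<union> X' \<union> D)"
      "locating V E (S \<union> R \<union> X' \<union> (X - X' - D))"
      using complementary_extensions[of X'] by blast
    have fin: "finite X'" "finite D"
      using X' D(1) finite_sets(1) by (auto intro: finite_subset)
    have disj: "(S \<union> R) \<inter> X = {}" using sub by auto
    have card: "card (S \<union> R \<union> X' \<union> B) = card S + card R + card X' + card B"
      if "B \<subseteq> X - X'" for B
    proof -
      have "card (S \<union> R \<union> X' \<union> B) = card (S \<union> R \<union> X') + card B"
        using that disj finite_sets fin by (intro card_Un_disjoint) (auto intro: finite_subset)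
      also have "card (S \<union> R \<union> X') = card (S \<union> R) + card X'"
        using X' disj finite_sets fin by (intro card_Un_disjoint) auto
      finally show ?thesis using SR by simp
    qed
    have "card X' \<le> card X" "card D \<le> card (X - X')"
      using X' D(1) finite_sets by (auto intro!: card_mono)
    then have "card X' + card D + card (X - X' - D) = card X"
      using X' D(1) fin by (simp add: card_Diff_subset)
    moreover have "5 * card V \<le> 8 * (card S + card R + card X' + card D)"
      using large[OF D(2)] card[OF D(1)] by simp
    moreover have "5 * card V \<le> 8 * (card S + card R + card X' + card (X - X' - D))"
      using large[OF D(3)] card[of "X - X' - D"] by auto
    \<comment> \<open>With the weights 2, 3, 1, 1, 1 the coefficients of \<open>card X\<close>,
      \<open>card S\<close> and \<open>card C\<close> all become 5. What remains is
      \<open>card X' - card R\<close>, which is negative.\<close>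
    ultimately show False using b1 b2 b3 card_V X'(2) by (simp add: algebra_simps)
  qed
qed

end

theorem theorem1:
  fixes V :: "'a set" and E :: "'a set set"
  assumes "simple_graph V E" and "twin_free V E"
  shows "LD V E \<le> nat \<lceil>5 * real (card V) / 8\<rceil>"
proof -
  interpret twin_free_graph V E by unfold_locales (use assms in auto)
  have LD_le: "LD V E \<le> card Y" if "locating_dominating V E Y" for Y
  proof -
    have "{Y. locating_dominating V E Y} \<subseteq> Pow V"
      by (auto simp: locating_dominating_def locating_def)
    then have "finite {Y. locating_dominating V E Y}" using finite_V by (simp add: finite_subset)
    then show ?thesis using that by (auto simp: LD_def)
  qed
  show ?thesis
  proof (cases "V = {}")
    \<comment> \<open>The strict bound used below fails for the empty graph.\<close>
    case True
    then have "locating_dominating V E {}"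
      by (simp add: locating_dominating_def locating_def dominating_def)
    then show ?thesis using LD_le[of "{}"] by simp
  next
    case False
    obtain X where "X \<subseteq> V" "\<forall>w\<in>V - X. num_tr (insert w X) \<le> num_tr X"
      "\<forall>x\<in>X. num_tr (X - {x}) < num_tr X"
      using exists_extremal by blast
    then interpret extremal_trace_set V E X by unfold_locales auto
    obtain Y where Y: "locating V E Y" "8 * card Y < 5 * card V"
      using exists_small_locating[OF False] by blast
    obtain Y' where Y': "locating_dominating V E Y'" "card Y' \<le> card Y + 1"
      using locating_imp_locating_dominating[OF Y(1)] by blast
    have "real (card Y) < 5 * real (card V) / 8" using Y(2) by linarith
    \<comment> \<open>Strictness below the ceiling pays for the one vertex added for
      domination.\<close>
    then have "int (card Y) < \<lceil>5 * real (card V) / 8\<rceil>" by (simp add: less_ceiling_iff)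
    then show ?thesis using LD_le[OF Y'(1)] Y'(2) by linarith
  qed
qed

end
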